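(* Let $n\ge 1$ and let $R=\mathbb M_n(T)$, where $T$ is a local ring or a nonzero commutative ring. Then $R$ has Property K if and only if either $n\in\{4,6,8,\dots\}$, or $n=2$ and $1_T\in \mathrm U(T)+\mathrm U(T)$. Moreover, if $(T,\mathfrak m)$ is a local ring, the condition $1_T\in \mathrm U(T)+\mathrm U(T)$ is equivalent to $|T/\mathfrak m|>2$.
   Context: Rings are associative with identity. A local ring $(T,\mathfrak m)$ is a nonzero, possibly noncommutative, ring whose non-units form an ideal $\mathfrak m$ (equivalently, $T/\mathfrak m$ is a division ring, where $\mathfrak m$ is the Jacobson radical of $T$). $\mathrm U(T)$ is the group of units of $T$, and $\mathrm U(T)+\mathrm U(T)$ is the set of sums of two units. A ring $R$ has Property K if there exist idempotents $e,e'\in R$ such that the commutator $ee'-e'e$ is a unit of $R$. *)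

theory Defs
  imports "Jordan_Normal_Form.VS_Connect" "HOL-Algebra.QuotRing"
begin

text \<open>The class \<^class>\<open>ring_1\<close> includes the axiom that zero differs from one, so it describes
  exactly the nonzero (not necessarily commutative) associative rings with identity.  The record
  \<^const>\<open>ring_mat\<close> is the ring of square matrices over such a type; the library proves
  that it is a ring only for commutative coefficients.\<close>

lemma ring_mat_ring_1: "ring (ring_mat TYPE('a :: ring_1) n b)"
proof -
  interpret semiring "ring_mat TYPE('a) n b" by (rule semiring_mat)
  show ?thesis
    by (unfold_locales, insert add_inv_exists_mat, auto simp: ring_mat_def Units_def
      add_mult_distrib_mat[of _ n n _ _ n] mult_add_distrib_mat[of _ n n _ n])
qed

definition property_K :: "('a, 'b) ring_scheme \<Rightarrow> bool" where
  "property_K R \<longleftrightarrow>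
     (\<exists>e\<in>carrier R. \<exists>e'\<in>carrier R.
        e \<otimes>\<^bsub>R\<^esub> e = e \<and> e' \<otimes>\<^bsub>R\<^esub> e' = e' \<and>
        (e \<otimes>\<^bsub>R\<^esub> e') \<ominus>\<^bsub>R\<^esub> (e' \<otimes>\<^bsub>R\<^esub> e) \<in> Units R)"

definition nonunits :: "('a, 'b) ring_scheme \<Rightarrow> 'a set" where
  "nonunits R = carrier R - Units R"

text \<open>In HOL-Algebra \<^const>\<open>ideal\<close> means a two-sided ideal, also over noncommutative
  rings.\<close>

definition local_ring :: "('a, 'b) ring_scheme \<Rightarrow> bool" where
  "local_ring R \<longleftrightarrow> ring R \<and> \<one>\<^bsub>R\<^esub> \<noteq> \<zero>\<^bsub>R\<^esub> \<and> ideal (nonunits R) R"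

end

theory Submission
  imports Defs "HOL-Library.Z2"
begin

text \<open>If \<open>1 = A + B\<close> with \<open>A\<close> and \<open>B\<close> invertible of size \<open>k\<close>, the idempotents with blocks
  \<open>[[1, 0], [0, 0]]\<close> and \<open>[[A, 1], [A B, B]]\<close> have the invertible commutator
  \<open>[[0, 1], [- A B, 0]]\<close>; such \<open>A\<close> and \<open>B\<close> exist over every ring when \<open>k \<ge> 2\<close>.
  Conversely, a commutator \<open>c\<close> of idempotents \<open>e, e'\<close> satisfies \<open>e c + c e = c\<close>, so if \<open>c\<close> is a
  unit then \<open>e\<close> and \<open>1 - e\<close> are conjugate.  Over a commutative ring this is exploited through
  determinants and traces.  Over a local ring, a maximal free summand of the image of \<open>e\<close>, of
  rank \<open>r\<close>, and its translate by \<open>c\<^sup>-\<^sup>1\<close> together span everything modulo the radical,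
  so \<open>n = 2 r\<close>.\<close>

subsection \<open>Sufficiency\<close>

definition ring_unit :: "'a :: ring_1 \<Rightarrow> bool" where
  "ring_unit a \<longleftrightarrow> (\<exists>b. a * b = 1 \<and> b * a = 1)"

text \<open>The inverse \<open>d\<close> of the commutator is part of the data, so that a ring
  homomorphism carries witnesses to witnesses simply by acting on the entries.\<close>

definition mat_K_witness :: "nat \<Rightarrow> 'a :: ring_1 mat \<Rightarrow> 'a mat \<Rightarrow> 'a mat \<Rightarrow> bool" where
  "mat_K_witness n e e' d \<longleftrightarrow>
     e \<in> carrier_mat n n \<and> e' \<in> carrier_mat n n \<and> d \<in> carrier_mat n n \<and>
     e * e = e \<and> e' * e' = e' \<and>
     (e * e' - e' * e) * d = 1\<^sub>m n \<and> d * (e * e' - e' * e) = 1\<^sub>m n"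

definition sum_two_units_mat :: "'a :: ring_1 itself \<Rightarrow> nat \<Rightarrow> bool" where
  "sum_two_units_mat ty k \<longleftrightarrow>
     (\<exists>A B P Q :: 'a mat. A \<in> carrier_mat k k \<and> B \<in> carrier_mat k k \<and>
        P \<in> carrier_mat k k \<and> Q \<in> carrier_mat k k \<and> A + B = 1\<^sub>m k \<and>
        A * P = 1\<^sub>m k \<and> P * A = 1\<^sub>m k \<and> B * Q = 1\<^sub>m k \<and> Q * B = 1\<^sub>m k)"

lemma Units_class_ring: "x \<in> Units (class_ring :: 'a :: ring_1 ring) \<longleftrightarrow> ring_unit x"
  by (auto simp: Units_def ring_unit_def)

lemma one_sum_of_units_iff:
  "(1 :: 'a :: ring_1) \<in> Units class_ring <+>\<^bsub>class_ring\<^esub> Units class_ring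
     \<longleftrightarrow> (\<exists>u. ring_unit (u :: 'a) \<and> ring_unit (1 - u))"
proof -
  have "(1 :: 'a) \<in> Units class_ring <+>\<^bsub>class_ring\<^esub> Units class_ring
    \<longleftrightarrow> (\<exists>u v. ring_unit u \<and> ring_unit v \<and> (1 :: 'a) = u + v)"
    unfolding set_add_def set_mult_def by (simp add: Bex_def Units_class_ring)
  also have "\<dots> \<longleftrightarrow> (\<exists>u. ring_unit (u :: 'a) \<and> ring_unit (1 - u))"
  proof safe
    fix u v :: 'a assume "ring_unit u" "ring_unit v" "1 = u + v"
    then have "1 - u = v" by (metis add_diff_cancel_left')
    with \<open>ring_unit u\<close> \<open>ring_unit v\<close> show "\<exists>u. ring_unit (u :: 'a) \<and> ring_unit (1 - u)" by blast
  next
    fix u :: 'a assume "ring_unit u" "ring_unit (1 - u)"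
    moreover have "1 = u + (1 - u)" by simp
    ultimately show "\<exists>u v. ring_unit u \<and> ring_unit v \<and> (1 :: 'a) = u + v" by blast
  qed
  finally show ?thesis .
qed

lemma property_K_ring_mat_iff:
  "property_K (ring_mat TYPE('a :: ring_1) n ()) \<longleftrightarrow> (\<exists>e e' d :: 'a mat. mat_K_witness n e e' d)"
proof -
  let ?R = "ring_mat TYPE('a) n ()"
  interpret R: ring ?R by (rule ring_mat_ring_1)
  \<comment> \<open>Subtraction in the record is addition of an abstractly chosen additive inverse;
    uniqueness of that inverse identifies it with entrywise subtraction.\<close>
  have minus: "x \<ominus>\<^bsub>?R\<^esub> y = x - y" if "x \<in> carrier_mat n n" "y \<in> carrier_mat n n" for x y :: "'a mat"
  proof -
    have "- y \<oplus>\<^bsub>?R\<^esub> y = \<zero>\<^bsub>?R\<^esub>" using that by (auto simp: ring_mat_simps)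
    then have "\<ominus>\<^bsub>?R\<^esub> y = - y"
      by (intro R.minus_equality) (use that in \<open>auto simp: ring_mat_simps\<close>)
    then show ?thesis using that by (simp add: a_minus_def ring_mat_simps minus_add_uminus_mat)
  qed
  show ?thesis
    unfolding property_K_def mat_K_witness_def Units_def
    by (simp add: ring_mat_simps minus mult_carrier_mat[of _ n n _ n] minus_carrier_mat) (auto simp: minus_carrier_mat mult_carrier_mat[of _ n n _ n])
qed

section \<open>Idempotents from writing the identity as a sum of two units\<close>

lemma add_left_cancel_mat:
  fixes X Y Z :: "'a :: group_add mat"
  assumes "X \<in> carrier_mat nr nc" "Y \<in> carrier_mat nr nc" "Z \<in> carrier_mat nr nc" "Z + X = Z + Y"
  shows "X = Y"
proof (rule eq_matI)
  fix i j assume ij: "i < dim_row Y" "j < dim_col Y"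
  have "(Z + X) $$ (i, j) = (Z + Y) $$ (i, j)" using assms(4) by simp
  then show "X $$ (i, j) = Y $$ (i, j)" using assms(1-3) ij by simp
qed (use assms in auto)

lemma mat_K_witness_if_sum_two_units:
  assumes "sum_two_units_mat TYPE('a :: ring_1) k"
  shows "\<exists>e e' d :: 'a mat. mat_K_witness (k + k) e e' d"
proof -
  obtain A B P Q :: "'a mat" where c[simp]: "A \<in> carrier_mat k k" "B \<in> carrier_mat k k"
      "P \<in> carrier_mat k k" "Q \<in> carrier_mat k k"
    and s: "A + B = 1\<^sub>m k" and i: "A * P = 1\<^sub>m k" "P * A = 1\<^sub>m k" "B * Q = 1\<^sub>m k" "Q * B = 1\<^sub>m k"
    using assms unfolding sum_two_units_mat_def by blast
  have AB[simp]: "A * B \<in> carrier_mat k k" "Q * P \<in> carrier_mat k k" by (auto intro: mult_carrier_mat[OF c(1,2)] mult_carrier_mat[OF c(4,3)])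
  note [simp] = c[THEN carrier_matD(1)] c[THEN carrier_matD(2)]
  note d = mult_add_distrib_mat[of _ k k _ k] add_mult_distrib_mat[of _ k k _ _ k]
  note a = assoc_mult_mat[of _ k k _ k _ k]
  have BA: "B * A \<in> carrier_mat k k" "A * A \<in> carrier_mat k k"
    by (auto intro: mult_carrier_mat[OF c(2,1)] mult_carrier_mat[OF c(1,1)])
  have 1: "A * A + A * B = A" using d(1)[OF c(1,1,2)] s c by simp
  have 2: "A * B + B * B = B" using d(2)[OF c(1,2,2)] s c by simp
  \<comment> \<open>Both \<open>A (A + B)\<close> and \<open>(A + B) A\<close> equal
    \<open>A\<close>; cancelling \<open>A A\<close> shows that \<open>A\<close> and \<open>B\<close>
    commute, whatever the coefficients.\<close>
  have "A * A + B * A = A" using d(2)[OF c(1,2,1)] s c by simp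
  then have comm: "B * A = A * B"
    using 1 BA AB(1) by (metis add_left_cancel_mat)
  define e :: "'a mat" where "e = four_block_mat (1\<^sub>m k) (0\<^sub>m k k) (0\<^sub>m k k) (0\<^sub>m k k)"
  \<comment> \<open>Since \<open>A B = B A\<close>, this is the column \<open>(1, B)\<close> times
    the row \<open>(A, 1)\<close>. The row times the column is \<open>A + B = 1\<close>, which is
    why \<open>e'\<close> is idempotent.\<close>
  define e' where "e' = four_block_mat A (1\<^sub>m k) (A * B) B"
  \<comment> \<open>The inverse of the commutator \<open>[[0, 1], [- A B, 0]]\<close>: the product
    \<open>Q P\<close> inverts \<open>A B\<close>.\<close>
  define f where "f = four_block_mat (0\<^sub>m k k) (- (Q * P)) (1\<^sub>m k) (0\<^sub>m k k)"
  note m = mult_four_block_mat[of _ k k _ k _ k _ _ k _ k]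
  have ee: "e * e = e" unfolding e_def by (subst m) auto
  have 3: "A * B * A + B * (A * B) = A * B"
  proof -
    have "B * (A * B) = A * B * B" using a[OF c(2,1,2)] comm by simp
    then show ?thesis using d(1)[OF AB(1) c(1,2)] right_mult_one_mat[OF AB(1)] s by simp
  qed
  have "e' * e' = four_block_mat (A * A + 1\<^sub>m k * (A * B)) (A * 1\<^sub>m k + 1\<^sub>m k * B)
      (A * B * A + B * (A * B)) (A * B * 1\<^sub>m k + B * B)"
    unfolding e'_def by (rule m) simp_all
  then have ee': "e' * e' = e'"
    unfolding left_mult_one_mat[OF AB(1)] left_mult_one_mat[OF c(2)]
      right_mult_one_mat[OF AB(1)] right_mult_one_mat[OF c(1)] 1 2 3 s e'_def .
  have "e * e' = four_block_mat A (1\<^sub>m k) (0\<^sub>m k k) (0\<^sub>m k k)"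
    unfolding e_def e'_def by (subst m) auto
  moreover have "e' * e = four_block_mat A (0\<^sub>m k k) (A * B) (0\<^sub>m k k)"
    unfolding e_def e'_def by (subst m) auto
  ultimately have cc: "e * e' - e' * e = four_block_mat (0\<^sub>m k k) (1\<^sub>m k) (- (A * B)) (0\<^sub>m k k)"
    by (intro eq_matI) (use c in auto)
  have 4: "A * B * (Q * P) = 1\<^sub>m k"
  proof -
    have "A * B * (Q * P) = A * ((B * Q) * P)" by (simp add: a)
    then show ?thesis using i by simp
  qed
  have 5: "Q * P * (A * B) = 1\<^sub>m k"
  proof -
    have "Q * P * (A * B) = Q * ((P * A) * B)" by (simp add: a)
    then show ?thesis using i by simp
  qed
  have z: "- 0\<^sub>m k k = (0\<^sub>m k k :: 'a mat)" by (rule eq_matI) auto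
  have r: "- X * - Y = X * Y" if "X \<in> carrier_mat k k" "Y \<in> carrier_mat k k" for X Y :: "'a mat"
    using that by auto
  have "(e * e' - e' * e) * f = four_block_mat (1\<^sub>m k) (0\<^sub>m k k) (0\<^sub>m k k) (1\<^sub>m k)"
    unfolding cc f_def by (subst m) (use 4 r[OF AB] z in auto)
  moreover have "f * (e * e' - e' * e) = four_block_mat (1\<^sub>m k) (0\<^sub>m k k) (0\<^sub>m k k) (1\<^sub>m k)"
    unfolding cc f_def by (subst m) (use 5 r[OF AB(2,1)] z in auto)
  moreover have "e \<in> carrier_mat (k + k) (k + k)" "e' \<in> carrier_mat (k + k) (k + k)" "f \<in> carrier_mat (k + k) (k + k)"
    unfolding e_def e'_def f_def by (auto intro!: four_block_carrier_mat)
  ultimately show ?thesis using ee ee' unfolding mat_K_witness_def by auto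
qed

text \<open>Block diagonal matrices combine the two decompositions. Starting from sizes 2 and 3,
  this reaches every size from 2 on.\<close>

lemma sum_two_units_mat_add:
  assumes "sum_two_units_mat TYPE('a :: ring_1) k" "sum_two_units_mat TYPE('a) l"
  shows "sum_two_units_mat TYPE('a) (k + l)"
proof -
  obtain A B P Q :: "'a mat" where c: "A \<in> carrier_mat k k" "B \<in> carrier_mat k k"
      "P \<in> carrier_mat k k" "Q \<in> carrier_mat k k"
    and s: "A + B = 1\<^sub>m k" and i: "A * P = 1\<^sub>m k" "P * A = 1\<^sub>m k" "B * Q = 1\<^sub>m k" "Q * B = 1\<^sub>m k"
    using assms(1) unfolding sum_two_units_mat_def by blast
  obtain A' B' P' Q' :: "'a mat" where c': "A' \<in> carrier_mat l l" "B' \<in> carrier_mat l l"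
      "P' \<in> carrier_mat l l" "Q' \<in> carrier_mat l l"
    and s': "A' + B' = 1\<^sub>m l" and i': "A' * P' = 1\<^sub>m l" "P' * A' = 1\<^sub>m l" "B' * Q' = 1\<^sub>m l" "Q' * B' = 1\<^sub>m l"
    using assms(2) unfolding sum_two_units_mat_def by blast
  let ?D = "\<lambda>X Y :: 'a mat. four_block_mat X (0\<^sub>m k l) (0\<^sub>m l k) Y"
  have mult: "?D X Y * ?D X' Y' = 1\<^sub>m (k + l)"
    if "X \<in> carrier_mat k k" "X' \<in> carrier_mat k k" "Y \<in> carrier_mat l l" "Y' \<in> carrier_mat l l"
      "X * X' = 1\<^sub>m k" "Y * Y' = 1\<^sub>m l" for X X' Y Y'
    by (subst mult_four_block_mat[of _ k k _ l _ l _ _ k _ l]) (use that in auto)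
  have "?D A A' + ?D B B' = 1\<^sub>m (k + l)"
    by (subst add_four_block_mat[of _ k k _ l _ l]) (use c c' s s' in auto)
  then show ?thesis unfolding sum_two_units_mat_def
    using mult c c' i i' four_block_carrier_mat by metis
qed

lemma sum_two_units_mat_2: "sum_two_units_mat TYPE('a :: ring_1) 2"
proof -
  \<comment> \<open>\<open>A\<close> is a companion matrix of \<open>x\<^sup>2 - x + 1\<close>, so
    \<open>A (1 - A) = 1\<close>: the matrices \<open>A\<close> and \<open>B = 1 - A\<close> are
    inverse to each other.\<close>
  define A B :: "'a mat" where "A = mat_of_rows_list 2 [[0, 1], [-1, 1]]"
    and "B = mat_of_rows_list 2 [[1, -1], [1, 0]]"
  have c: "A \<in> carrier_mat 2 2" "B \<in> carrier_mat 2 2"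
    by (auto simp: A_def B_def mat_of_rows_list_def)
  have "A + B = 1\<^sub>m 2" "A * B = 1\<^sub>m 2" "B * A = 1\<^sub>m 2"
    by (rule eq_matI; auto simp: A_def B_def mat_of_rows_list_def scalar_prod_def less_Suc_eq numeral_2_eq_2)+
  with c show ?thesis unfolding sum_two_units_mat_def by blast
qed

lemma sum_two_units_mat_3: "sum_two_units_mat TYPE('a :: ring_1) 3"
proof -
  define A B P Q :: "'a mat" where "A = mat_of_rows_list 3 [[0, 0, 1], [1, 0, 1], [0, 1, 0]]"
    and "B = mat_of_rows_list 3 [[1, 0, -1], [-1, 1, -1], [0, -1, 1]]"
    and "P = mat_of_rows_list 3 [[-1, 1, 0], [0, 0, 1], [1, 0, 0]]"
    and "Q = mat_of_rows_list 3 [[0, -1, -1], [-1, -1, -2], [-1, -1, -1]]"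
  have c: "A \<in> carrier_mat 3 3" "B \<in> carrier_mat 3 3" "P \<in> carrier_mat 3 3" "Q \<in> carrier_mat 3 3"
    by (auto simp: A_def B_def P_def Q_def mat_of_rows_list_def)
  \<comment> \<open>\<open>A\<close> is the companion matrix of \<open>x\<^sup>3 - x - 1\<close>, so
    \<open>A (A\<^sup>2 - 1) = 1\<close> and \<open>(A - 1) (A\<^sup>2 + A) = 1\<close>.\<close>
  have "A + B = 1\<^sub>m 3" "A * P = 1\<^sub>m 3" "P * A = 1\<^sub>m 3" "B * Q = 1\<^sub>m 3" "Q * B = 1\<^sub>m 3"
    by (rule eq_matI; auto simp: A_def B_def P_def Q_def mat_of_rows_list_def scalar_prod_def less_Suc_eq numeral_3_eq_3)+
  with c show ?thesis unfolding sum_two_units_mat_def by blast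
qed

lemma sum_two_units_mat_ge_2:
  assumes "k \<ge> 2"
  shows "sum_two_units_mat TYPE('a :: ring_1) k"
  using assms
proof (induction k rule: less_induct)
  case (less k)
  consider "k = 2" | "k = 3" | "k \<ge> 4" using less.prems by linarith
  then show ?case
  proof cases
    case 3
    then show ?thesis
      using sum_two_units_mat_add[OF less.IH[of "k - 2"] sum_two_units_mat_2]
      by (simp del: One_nat_def add_2_eq_Suc' add_2_eq_Suc)
  qed (simp_all add: sum_two_units_mat_2 sum_two_units_mat_3)
qed

lemma sum_two_units_mat_1:
  assumes "ring_unit (u :: 'a :: ring_1)" "ring_unit (1 - u)"
  shows "sum_two_units_mat TYPE('a) 1"
proof -
  obtain p q where pq: "u * p = 1" "p * u = 1" "(1 - u) * q = 1" "q * (1 - u) = 1"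
    using assms unfolding ring_unit_def by blast
  let ?M = "\<lambda>x :: 'a. mat 1 1 (\<lambda>_. x)"
  have "?M x * ?M y = ?M (x * y)" "?M x + ?M y = ?M (x + y)" "?M 1 = 1\<^sub>m 1" for x y
    by (rule eq_matI; simp add: scalar_prod_def)+
  then have "?M u + ?M (1 - u) = 1\<^sub>m 1" "?M u * ?M p = 1\<^sub>m 1" "?M p * ?M u = 1\<^sub>m 1"
     "?M (1 - u) * ?M q = 1\<^sub>m 1" "?M q * ?M (1 - u) = 1\<^sub>m 1"
    using pq by simp_all
  then show ?thesis unfolding sum_two_units_mat_def
    by (meson mat_carrier)
qed

subsection \<open>Commutative rings\<close>

text \<open>Invariance of the trace, by exchanging two sums. It is used to give \<open>e\<close> and
  its conjugate \<open>1 - e\<close> the same trace.\<close>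

lemma sum_diag_mult_comm:
  fixes A B :: "'a :: comm_ring_1 mat"
  assumes "A \<in> carrier_mat n n" "B \<in> carrier_mat n n"
  shows "(\<Sum>i<n. (A * B) $$ (i, i)) = (\<Sum>i<n. (B * A) $$ (i, i))"
proof -
  have *: "(\<Sum>i<n. (X * Y) $$ (i, i)) = (\<Sum>i<n. \<Sum>j<n. X $$ (i, j) * Y $$ (j, i))"
    if "X \<in> carrier_mat n n" "Y \<in> carrier_mat n n" for X Y :: "'a mat"
    using that by (intro sum.cong) (auto simp: scalar_prod_def atLeast0LessThan intro!: sum.cong)
  show ?thesis
    unfolding *[OF assms] *[OF assms(2,1)]
    by (subst sum.swap) (simp add: mult.commute)
qed

text \<open>As \<open>e\<close> is idempotent, \<open>e c = e e' - e e' e\<close> and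
  \<open>c e = e e' e - e' e\<close>, and the middle terms cancel in the sum. Equivalently
  \<open>c e = (1 - e) c\<close>, so an invertible \<open>c\<close> conjugates \<open>e\<close> into
  \<open>1 - e\<close>.\<close>

lemma mat_K_witness_twist:
  fixes e e' d :: "'a :: ring_1 mat"
  assumes "mat_K_witness n e e' d"
  defines "c \<equiv> e * e' - e' * e"
  shows "c \<in> carrier_mat n n" "e * c + c * e = c"
proof -
  have e[simp]: "e \<in> carrier_mat n n" "e' \<in> carrier_mat n n" and ee: "e * e = e"
    using assms(1) by (auto simp: mat_K_witness_def)
  have m[simp]: "X * Y \<in> carrier_mat n n" if "X \<in> carrier_mat n n" "Y \<in> carrier_mat n n" for X Y :: "'a mat"
    using that by (rule mult_carrier_mat)
  show "c \<in> carrier_mat n n" unfolding c_def by (intro minus_carrier_mat m e)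
  note a = assoc_mult_mat[of _ n n _ n _ n]
  have "e * (e * e') = e * e'" using a[of e e e'] ee by simp
  then have 1: "e * c = e * e' - e * e' * e"
    unfolding c_def by (subst mult_minus_distrib_mat[of _ n n _ n]) (simp_all add: a)
  have "e' * e * e = e' * e" using a[of e' e e] ee by simp
  then have 2: "c * e = e * e' * e - e' * e"
    unfolding c_def by (subst minus_mult_distrib_mat[of _ n n _ _ n]) (simp_all add: a)
  have "(x - y) + (y - z) = x - z" if "x \<in> carrier_mat n n" "y \<in> carrier_mat n n" "z \<in> carrier_mat n n" for x y z :: "'a mat"
    using that by (intro eq_matI) auto
  from this[of "e * e'" "e * e' * e" "e' * e"] show "e * c + c * e = c"
    unfolding 1 2 by (simp add: c_def)
qed

text \<open>For \<open>n\<close> odd, \<open>s = 2 e - 1\<close> is an involution with \<open>s c = - c s\<close>, so determinants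
  give \<open>2 = 0\<close>.  As \<open>e\<close> and \<open>1 - e\<close> are conjugate under \<open>c\<close>, traces give \<open>n = 2 tr e = 0\<close>,
  hence \<open>1 = 0\<close>.\<close>

lemma mat_K_witness_even_comm:
  fixes e e' d :: "'a :: comm_ring_1 mat"
  assumes K: "mat_K_witness n e e' d"
  shows "even n"
proof (rule ccontr)
  assume n: "odd n"
  define c where "c = e * e' - e' * e"
  note twist = mat_K_witness_twist[OF K, folded c_def]
  have e[simp]: "e \<in> carrier_mat n n" "d \<in> carrier_mat n n" and ee: "e * e = e"
    and cd: "c * d = 1\<^sub>m n" and dc: "d * c = 1\<^sub>m n"
    using K by (auto simp: mat_K_witness_def c_def)
  note c[simp] = twist(1)
  have m[simp]: "X * Y \<in> carrier_mat n n" if "X \<in> carrier_mat n n" "Y \<in> carrier_mat n n" for X Y :: "'a mat"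
    using that by (rule mult_carrier_mat)
  note a = assoc_mult_mat[of _ n n _ n _ n]
  note [simp] = e[THEN carrier_matD(1)] e[THEN carrier_matD(2)] c[THEN carrier_matD(1)] c[THEN carrier_matD(2)]
  note distl = mult_minus_distrib_mat[of _ n n _ n] mult_add_distrib_mat[of _ n n _ n]
  note distr = minus_mult_distrib_mat[of _ n n _ _ n] add_mult_distrib_mat[of _ n n _ _ n]
  define s where "s = e + e - 1\<^sub>m n"
  have s[simp]: "s \<in> carrier_mat n n" unfolding s_def by auto
  note [simp] = s[THEN carrier_matD(1)] s[THEN carrier_matD(2)]
  have "s * e = e"
  proof -
    have "s * e = (e * e + e * e) - 1\<^sub>m n * e"
      unfolding s_def by (subst distr, simp_all)+
    also have "\<dots> = e" unfolding ee left_mult_one_mat[OF e(1)]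
      by (intro eq_matI) (use carrier_matD[OF e(1)] in auto)
    finally show ?thesis .
  qed
  then have ss: "s * s = 1\<^sub>m n"
  proof -
    have "s * s = (s * e + s * e) - s * 1\<^sub>m n"
      by (subst (2) s_def) (subst distl, simp_all)+
    also have "\<dots> = (e + e) - s" using \<open>s * e = e\<close> by simp
    also have "\<dots> = 1\<^sub>m n" unfolding s_def by (intro eq_matI) auto
    finally show ?thesis .
  qed
  have "s * c = (e * c + e * c) - c"
    unfolding s_def by (subst distr, simp_all)+
  moreover have "c * s = (c * e + c * e) - c"
    unfolding s_def by (subst distl, simp_all)+
  \<comment> \<open>Taken at \<open>x = e c\<close> and \<open>y = c e\<close>, where
    \<open>x + y = c\<close> by the twist identity, this says that \<open>s\<close> and
    \<open>c\<close> anticommute.\<close>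
  moreover have "(x + x) - (x + y) = (-1) \<cdot>\<^sub>m ((y + y) - (x + y))"
    if "x \<in> carrier_mat n n" "y \<in> carrier_mat n n" for x y :: "'a mat"
    using that by (intro eq_matI) auto
  ultimately have "s * c = (-1) \<cdot>\<^sub>m (c * s)"
    by (metis twist(2) m e(1) c)
  then have "det s * det c = (-1) ^ n * (det c * det s)"
    by (metis det_mult det_smult s c m carrier_matD(2))
  then have "det s * det c = - (det s * det c)" using n by simp
  then have "(det s * det c + det s * det c) * (det s * det d) = 0"
    by (simp only: eq_neg_iff_add_eq_0 mult_zero_left)
  moreover have "(det s * det c) * (det s * det d) = 1"
  proof -
    have "det s * det s = 1" "det c * det d = 1"
      by (metis det_mult ss s det_one, metis det_mult cd c e(2) det_one)
    then show ?thesis by (metis mult.left_commute mult.assoc mult_1)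
  qed
  ultimately have two: "(1 :: 'a) + 1 = 0" by (simp only: distrib_right)
  \<comment> \<open>Multiplying the twist identity by \<open>d\<close> yields
    \<open>d e c = 1 - e\<close>, and the trace of \<open>d e c\<close> is that of
    \<open>e c d = e\<close>.\<close>
  have "d * (e * c) + d * (c * e) = 1\<^sub>m n"
    using distl(2)[of d "e * c" "c * e"] twist(2) dc by simp
  moreover have "d * (c * e) = e" using a[of d c e] dc by simp
  ultimately have *: "d * (e * c) + e = 1\<^sub>m n" by simp
  have "(\<Sum>i<n. (d * (e * c)) $$ (i, i)) = (\<Sum>i<n. (e * c * d) $$ (i, i))"
    by (rule sum_diag_mult_comm) simp_all
  also have "e * c * d = e" using a[of e c d] cd by simp
  finally have "(\<Sum>i<n. (1\<^sub>m n :: 'a mat) $$ (i, i)) = (\<Sum>i<n. e $$ (i, i)) + (\<Sum>i<n. e $$ (i, i))"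
    unfolding *[symmetric] by (simp add: sum.distrib carrier_matD[OF e(1)])
  also have "\<dots> = 0" using two by (metis distrib_right mult_1 mult_zero_left)
  finally have "of_nat n = (0 :: 'a)" by simp
  moreover have "of_nat n = (1 :: 'a)"
  proof -
    obtain k where k: "n = 2 * k + 1" using n by (elim oddE)
    have "of_nat n = (1 + 1) * of_nat k + (1 :: 'a)" by (simp add: k)
    then show ?thesis unfolding two by simp
  qed
  ultimately show False by simp
qed

text \<open>Both idempotents have determinant \<open>0\<close> and trace \<open>1\<close>, because multiplication by
  \<open>det e\<close> or \<open>det (1 - e)\<close> kills the unit \<open>c = e e' - e' e\<close>.  Then \<open>det c = u (1 - u)\<close>
  with \<open>u = tr (e e')\<close>.\<close>

lemma mat_K_witness_2_comm:
  fixes e e' d :: "'a :: comm_ring_1 mat"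
  assumes K: "mat_K_witness 2 e e' d"
  shows "\<exists>u :: 'a. ring_unit u \<and> ring_unit (1 - u)"
proof -
  define c where "c = e * e' - e' * e"
  note twist = mat_K_witness_twist[OF K, folded c_def]
  have e: "e \<in> carrier_mat 2 2" "e' \<in> carrier_mat 2 2" "d \<in> carrier_mat 2 2"
    and ee: "e * e = e" "e' * e' = e'" and cd: "c * d = 1\<^sub>m 2"
    using K by (auto simp: mat_K_witness_def c_def)
  have mult: "(X * Y) $$ (i, j) = X $$ (i, 0) * Y $$ (0, j) + X $$ (i, 1) * Y $$ (1, j)"
    if "X \<in> carrier_mat 2 2" "Y \<in> carrier_mat 2 2" "i < 2" "j < 2" for X Y :: "'a mat" and i j
    using that by (simp add: scalar_prod_def numeral_2_eq_2)
  obtain p q r s where pqrs: "e $$ (0,0) = p" "e $$ (0,1) = q" "e $$ (1,0) = r" "e $$ (1,1) = s" by blast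
  obtain p' q' r' s' where pqrs': "e' $$ (0,0) = p'" "e' $$ (0,1) = q'" "e' $$ (1,0) = r'" "e' $$ (1,1) = s'" by blast
  obtain w x y z where d: "d $$ (0,0) = w" "d $$ (0,1) = x" "d $$ (1,0) = y" "d $$ (1,1) = z" by blast
  have idem: "p * p + q * r = p" "p * q + q * s = q" "r * p + s * r = r" "r * q + s * s = s"
    using mult[OF e(1,1)] unfolding ee pqrs by (metis pqrs zero_less_numeral one_less_numeral_iff semiring_norm(76))+
  have idem': "p' * p' + q' * r' = p'" "p' * q' + q' * s' = q'" "r' * p' + s' * r' = r'" "r' * q' + s' * s' = s'"
    using mult[OF e(2,2)] unfolding ee pqrs' by (metis pqrs' zero_less_numeral one_less_numeral_iff semiring_norm(76))+
  define c0 c1 c2 where "c0 = q * r' - q' * r" and "c1 = p * q' + q * s' - (p' * q + q' * s)"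
    and "c2 = r * p' + s * r' - (r' * p + s' * r)"
  have c: "c $$ (0,0) = c0" "c $$ (0,1) = c1" "c $$ (1,0) = c2" "c $$ (1,1) = - c0"
    using e mult[OF e(1,2)] mult[OF e(2,1)] pqrs pqrs' unfolding c_def
    by (auto simp: c0_def c1_def c2_def algebra_simps)
  have cd_entries: "c0 * w + c1 * y = 1" "c0 * x + c1 * z = 0" "c2 * w - c0 * y = 0" "c2 * x - c0 * z = 1"
    using mult[OF twist(1) e(3), of 0 0] mult[OF twist(1) e(3), of 0 1]
      mult[OF twist(1) e(3), of 1 0] mult[OF twist(1) e(3), of 1 1]
    unfolding cd c d by simp_all
  \<comment> \<open>This is \<open>det c * det d = 1\<close> in coordinates; the first factor is
    \<open>det c\<close>, because \<open>c\<close> has trace 0.\<close>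
  then have unit: "(- c0 * c0 - c1 * c2) * (w * z - x * y) = 1"
  proof -
    have "(- c0 * c0 - c1 * c2) * (w * z - x * y)
        = (c0 * w + c1 * y) * (c2 * x - c0 * z) - (c0 * x + c1 * z) * (c2 * w - c0 * y)"
      by (simp add: algebra_simps)
    with cd_entries show ?thesis by simp
  qed
  \<comment> \<open>An element that kills the first row of \<open>c\<close> kills its determinant,
    which is a unit.\<close>
  have zero: "f = 0" if "f * c0 = 0" "f * c1 = 0" for f
  proof -
    have "f = f * ((- c0 * c0 - c1 * c2) * (w * z - x * y))" using unit by simp
    also have "\<dots> = - (f * c0 * c0 + f * c1 * c2) * (w * z - x * y)" by (simp add: algebra_simps)
    finally show ?thesis using that by simp
  qed
  \<comment> \<open>For an idempotent \<open>M\<close>, multiplying \<open>adj M * M = det M\<close>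
    by \<open>M\<close> gives \<open>det M * M = det M\<close>. So \<open>det M\<close> kills the
    off-diagonal entries and the difference of the diagonal ones.\<close>
  have adj: "(P * S - Q * R) * Q = 0 \<and> (P * S - Q * R) * R = 0 \<and> (P * S - Q * R) * (P - S) = 0"
    if "P * P + Q * R = P" "P * Q + Q * S = Q" "R * P + S * R = R" "R * Q + S * S = S" for P Q R S :: 'a
  proof -
    have "(P * S - Q * R) * Q = S * (P * Q + Q * S - Q) - Q * (R * Q + S * S - S)"
      "(P * S - Q * R) * R = S * (R * P + S * R - R) - R * (R * Q + S * S - S)"
      "(P * S - Q * R) * (P - S) = S * (P * P + Q * R - P) - P * (R * Q + S * S - S)"
      by (simp_all add: algebra_simps)
    then show ?thesis using that by simp
  qed
  have compl: "(1 - P) * (1 - P) + - Q * - R = 1 - P \<and> (1 - P) * - Q + - Q * (1 - S) = - Q \<and>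
      - R * (1 - P) + (1 - S) * - R = - R \<and> - R * - Q + (1 - S) * (1 - S) = 1 - S"
    if "P * P + Q * R = P" "P * Q + Q * S = Q" "R * P + S * R = R" "R * Q + S * S = S" for P Q R S :: 'a
  proof -
    have "(1 - P) * (1 - P) + - Q * - R = (1 - P) + (P * P + Q * R - P)"
      "(1 - P) * - Q + - Q * (1 - S) = - Q + (P * Q + Q * S - Q)"
      "- R * (1 - P) + (1 - S) * - R = - R + (R * P + S * R - R)"
      "- R * - Q + (1 - S) * (1 - S) = (1 - S) + (R * Q + S * S - S)"
      by (simp_all add: algebra_simps)
    then show ?thesis using that by simp
  qed
  \<comment> \<open>Adding a scalar matrix to \<open>e\<close> does not change \<open>c\<close>, so
    \<open>c\<close> depends on \<open>e\<close> only through \<open>q\<close>, \<open>r\<close> and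
    \<open>p - s\<close>.\<close>
  have kill: "f = 0" if "f * q = 0" "f * r = 0" "f * (p - s) = 0" for f
  proof (rule zero)
    have "f * c0 = (f * q) * r' - (f * r) * q'" by (simp add: c0_def algebra_simps)
    then show "f * c0 = 0" using that by simp
    have "f * c1 = (f * (p - s)) * q' - (f * q) * (p' - s')" by (simp add: c1_def algebra_simps)
    then show "f * c1 = 0" using that by simp
  qed
  have kill': "f = 0" if "f * q' = 0" "f * r' = 0" "f * (p' - s') = 0" for f
  proof (rule zero)
    have "f * c0 = (f * r') * q - (f * q') * r" by (simp add: c0_def algebra_simps)
    then show "f * c0 = 0" using that by simp
    have "f * c1 = (f * q') * (p - s) - (f * (p' - s')) * q" by (simp add: c1_def algebra_simps)
    then show "f * c1 = 0" using that by simp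
  qed
  have f: "p * s - q * r = 0" using kill adj[OF idem] by blast
  have f': "p' * s' - q' * r' = 0" using kill' adj[OF idem'] by blast
  \<comment> \<open>\<open>g\<close> is \<open>det (1 - e) = 1 - tr e + det e\<close>. It vanishes
    by the same argument applied to the idempotent \<open>1 - e\<close>, and this leaves
    \<open>tr e = 1\<close>.\<close>
  define g where "g = (1 - p) * (1 - s) - (- q) * (- r)"
  have "g * (- q) = 0 \<and> g * (- r) = 0 \<and> g * ((1 - p) - (1 - s)) = 0"
    using compl[OF idem] adj[of "1 - p" "- q" "- r" "1 - s"] unfolding g_def by blast
  moreover have "(1 - p) - (1 - s) = - (p - s)" by simp
  ultimately have "g * q = 0" "g * r = 0" "g * (p - s) = 0"
    by (simp_all only: mult_minus_right neg_equal_0_iff_equal)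
  then have "g = 0" by (rule kill)
  moreover have "g = 1 - (p + s) + (p * s - q * r)"
    unfolding g_def by (simp add: algebra_simps)
  ultimately have t: "p + s = 1" using f by simp
  define g' where "g' = (1 - p') * (1 - s') - (- q') * (- r')"
  have "g' * (- q') = 0 \<and> g' * (- r') = 0 \<and> g' * ((1 - p') - (1 - s')) = 0"
    using compl[OF idem'] adj[of "1 - p'" "- q'" "- r'" "1 - s'"] unfolding g'_def by blast
  moreover have "(1 - p') - (1 - s') = - (p' - s')" by simp
  ultimately have "g' * q' = 0" "g' * r' = 0" "g' * (p' - s') = 0"
    by (simp_all only: mult_minus_right neg_equal_0_iff_equal)
  then have "g' = 0" by (rule kill')
  moreover have "g' = 1 - (p' + s') + (p' * s' - q' * r')"
    unfolding g'_def by (simp add: algebra_simps)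
  ultimately have t': "p' + s' = 1" using f' by simp
  define u where "u = p * p' + q * r' + r * q' + s * s'"
  have s: "s = 1 - p" "s' = 1 - p'" using t t' by (metis add_diff_cancel_left')+
  have qr: "q * r = p * (1 - p)" "q' * r' = p' * (1 - p')" using f f' unfolding s by simp_all
  have "- c0 * c0 - c1 * c2 = u * (1 - u)"
  proof -
    \<comment> \<open>\<open>?k\<close> is the diagonal part of \<open>u\<close>. In the difference
      below the off-diagonal entries occur only in the products \<open>q r\<close> and
      \<open>q' r'\<close>, which the vanishing determinants turn into polynomials in
      \<open>p\<close> and \<open>p'\<close>.\<close>
    let ?k = "p * p' + (1 - p) * (1 - p')"
    have "- c0 * c0 - c1 * c2 - u * (1 - u) =
        4 * ((q * r) * (q' * r')) + (q' * r') * ((p - (1 - p)) * (p - (1 - p)))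
          + (q * r) * ((p' - (1 - p')) * (p' - (1 - p'))) - ?k * (1 - ?k)"
      unfolding u_def c0_def c1_def c2_def s by (simp add: algebra_simps)
    also have "\<dots> = 0" unfolding qr by (simp add: algebra_simps)
    finally show ?thesis by simp
  qed
  with unit have "u * ((1 - u) * (w * z - x * y)) = 1" by (simp only: mult.assoc)
  moreover from this have "(1 - u) * (u * (w * z - x * y)) = 1" by (simp only: mult.left_commute)
  ultimately show ?thesis unfolding ring_unit_def by (metis mult.commute)
qed

text \<open>Serves to move a witness into the centre when the ring is commutative, and into the
  field with two elements when that is the residue ring.\<close>

lemma mat_K_witness_hom:
  assumes "Ring_Hom.ring_hom (h :: 'a :: ring_1 \<Rightarrow> 'b :: ring_1)" and K: "mat_K_witness n e e' d"
  shows "mat_K_witness n (map_mat h e) (map_mat h e') (map_mat h d)"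
proof -
  interpret Ring_Hom.ring_hom h by fact
  have minus: "map_mat h (X - Y) = map_mat h X - map_mat h Y"
    if "X \<in> carrier_mat n n" "Y \<in> carrier_mat n n" for X Y
    using that by (intro eq_matI) (auto simp: hom_minus)
  have e: "e \<in> carrier_mat n n" "e' \<in> carrier_mat n n" "d \<in> carrier_mat n n"
    using K by (auto simp: mat_K_witness_def)
  have ee': "e * e' \<in> carrier_mat n n" "e' * e \<in> carrier_mat n n" "e * e' - e' * e \<in> carrier_mat n n"
    using e by (auto intro!: minus_carrier_mat mult_carrier_mat[of _ n n _ n])
  have c: "map_mat h e * map_mat h e' - map_mat h e' * map_mat h e = map_mat h (e * e' - e' * e)"
    by (simp only: minus[OF ee'(1,2)] mat_hom_mult[OF e(1,2)] mat_hom_mult[OF e(2,1)])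
  show ?thesis
    using K e unfolding mat_K_witness_def c
    by (simp add: mat_hom_one flip: mat_hom_mult[OF e(1,1)] mat_hom_mult[OF e(2,2)]
      mat_hom_mult[OF ee'(3) e(3)] mat_hom_mult[OF e(3) ee'(3)])
qed

text \<open>Determinants are available only over the class \<^class>\<open>comm_ring_1\<close>, while here
  commutativity is a hypothesis on a type of class \<^class>\<open>ring_1\<close>.  The centre is always
  commutative, and it is the whole ring under that hypothesis.\<close>

typedef (overloaded) 'a center = "{x :: 'a :: ring_1. \<forall>y. x * y = y * x}"
  morphisms center_elem Abs_center
  by (rule exI[of _ 0]) simp

setup_lifting type_definition_center

instantiation center :: (ring_1) comm_ring_1
begin
lift_definition zero_center :: "'a center" is 0 by simp
lift_definition one_center :: "'a center" is 1 by simp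
lift_definition plus_center :: "'a center \<Rightarrow> 'a center \<Rightarrow> 'a center" is "(+)"
  by (simp add: algebra_simps)
lift_definition minus_center :: "'a center \<Rightarrow> 'a center \<Rightarrow> 'a center" is "(-)"
  by (simp add: algebra_simps)
lift_definition uminus_center :: "'a center \<Rightarrow> 'a center" is uminus
  by simp
lift_definition times_center :: "'a center \<Rightarrow> 'a center \<Rightarrow> 'a center" is "(*)"
  by (metis mult.assoc)
instance
proof
  fix a b c :: "'a center"
  show "a * b = b * a" by transfer blast
qed (simp_all flip: center_elem_inject add: zero_center.rep_eq one_center.rep_eq plus_center.rep_eq
  minus_center.rep_eq uminus_center.rep_eq times_center.rep_eq algebra_simps)
end

lemma ring_hom_Abs_center:
  assumes comm: "\<And>x y :: 'a :: ring_1. x * y = y * x"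
  shows "Ring_Hom.ring_hom (Abs_center :: 'a \<Rightarrow> _)"
proof -
  have [simp]: "center_elem (Abs_center x) = x" for x :: 'a
    by (rule Abs_center_inverse) (simp add: comm)
  show ?thesis
    by unfold_locales (simp_all flip: center_elem_inject
      add: zero_center.rep_eq one_center.rep_eq plus_center.rep_eq times_center.rep_eq)
qed

lemma ring_unit_center_elem: "ring_unit x \<Longrightarrow> ring_unit (center_elem x)"
  unfolding ring_unit_def by (metis one_center.rep_eq times_center.rep_eq)

lemma mat_K_witness_commutative:
  fixes e e' d :: "'a :: ring_1 mat"
  assumes "\<And>x y :: 'a. x * y = y * x" and "mat_K_witness n e e' d"
  shows "even n" "n = 2 \<Longrightarrow> \<exists>u :: 'a. ring_unit u \<and> ring_unit (1 - u)"
proof -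
  note K = mat_K_witness_hom[OF ring_hom_Abs_center[OF assms(1)] assms(2)]
  show "even n" by (rule mat_K_witness_even_comm[OF K])
  assume "n = 2"
  with K mat_K_witness_2_comm obtain u :: "'a center" where "ring_unit u" "ring_unit (1 - u)"
    by blast
  then have "ring_unit (center_elem u)" "ring_unit (1 - center_elem u)"
    by (auto dest!: ring_unit_center_elem simp: minus_center.rep_eq one_center.rep_eq)
  then show "\<exists>u :: 'a. ring_unit u \<and> ring_unit (1 - u)" by blast
qed

subsection \<open>Local rings\<close>

text \<open>The ideal of nonunits as a plain set over the type, so that the arithmetic of the type
  class applies without carriers.\<close>

locale local_type =
  fixes N :: "'a :: ring_1 set"
  assumes mem_iff: "x \<in> N \<longleftrightarrow> \<not> ring_unit x"
    and add_mem: "x \<in> N \<Longrightarrow> y \<in> N \<Longrightarrow> x + y \<in> N"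
    and mult_left_mem: "x \<in> N \<Longrightarrow> y * x \<in> N"
    and mult_right_mem: "x \<in> N \<Longrightarrow> x * y \<in> N"
    and zero_mem: "0 \<in> N"
begin

lemma minus_mem: "x \<in> N \<Longrightarrow> - x \<in> N"
  using mult_left_mem[of x "- 1"] by simp

lemma diff_mem: "x \<in> N \<Longrightarrow> y \<in> N \<Longrightarrow> x - y \<in> N"
  using add_mem[OF _ minus_mem, of x y] by simp

lemma sum_mem: "(\<And>t. t \<in> J \<Longrightarrow> f t \<in> N) \<Longrightarrow> sum f J \<in> N"
  by (induction J rule: infinite_finite_induct) (auto simp: zero_mem add_mem)

lemma one_not_mem: "1 \<notin> N"
  unfolding mem_iff ring_unit_def by auto

text \<open>Gaussian elimination: some entry of row \<open>a\<close> is a unit, so row \<open>a\<close> and the column of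
  that entry can be cleared and removed.\<close>

lemma card_le_card_if_mod_inverse:
  assumes "finite I" "finite J"
    and "\<And>i l. i \<in> I \<Longrightarrow> l \<in> I \<Longrightarrow> (\<Sum>t\<in>J. X i t * Y t l) - (if i = l then 1 else 0) \<in> N"
  shows "card I \<le> card J"
  using assms
proof (induction I arbitrary: J X rule: finite_induct)
  case (insert a I)
  have "(\<Sum>t\<in>J. X a t * Y t a) - 1 \<in> N" using insert.prems(2)[of a a] by simp
  \<comment> \<open>If all of row \<open>a\<close> lay in \<open>N\<close>, so would its product
    with column \<open>a\<close> of \<open>Y\<close>, which is 1 modulo \<open>N\<close>.\<close>
  have "\<exists>j\<in>J. X a j \<notin> N"
  proof (rule ccontr)
    assume "\<not> ?thesis"
    then have "(\<Sum>t\<in>J. X a t * Y t a) \<in> N" by (intro sum_mem mult_right_mem) auto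
    from diff_mem[OF this \<open>_ - 1 \<in> N\<close>] show False using one_not_mem by simp
  qed
  then obtain j v where j: "j \<in> J" and v: "v * X a j = 1"
    unfolding mem_iff ring_unit_def by blast
  \<comment> \<open>Subtracting a left multiple of row \<open>a\<close> clears column
    \<open>j\<close>, since \<open>v * X a j = 1\<close>. The product with column \<open>l\<close>
    of \<open>Y\<close> changes by a multiple of its entry in row \<open>a\<close>, which is in
    \<open>N\<close> because \<open>l \<noteq> a\<close>.\<close>
  define X' where "X' i t = X i t - X i j * v * X a t" for i t
  have "card I \<le> card (J - {j})"
  proof (rule insert.IH)
    fix i l assume il: "i \<in> I" "l \<in> I"
    define S where "S i = (\<Sum>t\<in>J. X i t * Y t l)" for i
    have "X' i j = 0" by (simp add: X'_def mult.assoc v)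
    then have "(\<Sum>t\<in>J - {j}. X' i t * Y t l) = (\<Sum>t\<in>J. X' i t * Y t l)"
      using insert.prems(1) j by (simp add: sum.remove)
    also have "\<dots> = S i - X i j * v * S a"
      by (simp add: X'_def S_def left_diff_distrib sum_subtractf sum_distrib_left mult.assoc)
    finally have "(\<Sum>t\<in>J - {j}. X' i t * Y t l) - (if i = l then 1 else 0)
        = (S i - (if i = l then 1 else 0)) - X i j * v * S a" by simp
    moreover have "S i - (if i = l then 1 else 0) \<in> N"
      using insert.prems(2)[of i l] il unfolding S_def by simp
    moreover have "S a \<in> N"
      using insert.prems(2)[of a l] il insert.hyps unfolding S_def by (auto split: if_splits)
    ultimately show "(\<Sum>t\<in>J - {j}. X' i t * Y t l) - (if i = l then 1 else 0) \<in> N"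
      by (simp only: diff_mem mult_left_mem)
  qed (use insert.prems in auto)
  moreover have "card J = Suc (card (J - {j}))" using j insert.prems(1) by (rule card.remove[rotated])
  ultimately show ?case using insert.hyps by simp
qed simp

lemma dim_le_if_mod_inverse:
  assumes X: "X \<in> carrier_mat m k" and Y: "Y \<in> carrier_mat k m"
    and "\<And>i l. i < m \<Longrightarrow> l < m \<Longrightarrow> (X * Y - 1\<^sub>m m) $$ (i, l) \<in> N"
  shows "m \<le> k"
proof -
  have "card {..<m} \<le> card {..<k}"
  proof (rule card_le_card_if_mod_inverse)
    fix i l assume "i \<in> {..<m}" "l \<in> {..<m}"
    then show "(\<Sum>t\<in>{..<k}. X $$ (i, t) * Y $$ (t, l)) - (if i = l then 1 else 0) \<in> N"
      using assms(3)[of i l] X Y by (simp add: scalar_prod_def atLeast0LessThan)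
  qed simp_all
  then show ?thesis by simp
qed

lemma dim_le_if_inverse:
  fixes X Y :: "'a mat"
  assumes "X \<in> carrier_mat m k" "Y \<in> carrier_mat k m" "X * Y = 1\<^sub>m m"
  shows "m \<le> k"
  by (rule dim_le_if_mod_inverse[OF assms(1,2)]) (simp add: assms(3) zero_mem)

end

section \<open>Block rows, block columns and free summands\<close>

definition hcat :: "'a :: zero mat \<Rightarrow> 'a mat \<Rightarrow> 'a mat" where
  "hcat A B = four_block_mat A B (0\<^sub>m 0 (dim_col A)) (0\<^sub>m 0 (dim_col B))"

text \<open>As in \<open>hcat\<close>, empty blocks complete the pair to a four-block matrix, so
  that block multiplication covers all products of the two kinds.\<close>

definition vcat :: "'a :: zero mat \<Rightarrow> 'a mat \<Rightarrow> 'a mat" where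
  "vcat A B = four_block_mat A (0\<^sub>m (dim_row A) 0) B (0\<^sub>m (dim_row B) 0)"

lemma hcat_carrier: "A \<in> carrier_mat n r \<Longrightarrow> B \<in> carrier_mat n s \<Longrightarrow> hcat A B \<in> carrier_mat n (r + s)"
  by (auto simp: hcat_def)

lemma vcat_carrier: "A \<in> carrier_mat r n \<Longrightarrow> B \<in> carrier_mat s n \<Longrightarrow> vcat A B \<in> carrier_mat (r + s) n"
  by (auto simp: vcat_def)

lemma mult_hcat:
  fixes E :: "'a :: ring_1 mat"
  assumes "E \<in> carrier_mat m n" "A \<in> carrier_mat n r" "B \<in> carrier_mat n s"
  shows "E * hcat A B = hcat (E * A) (E * B)"
proof -
  have E: "E = four_block_mat E (0\<^sub>m m 0) (0\<^sub>m 0 n) (0\<^sub>m 0 0)"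
    by (rule eq_matI) (use assms in auto)
  show ?thesis
    unfolding hcat_def
    by (subst E, subst mult_four_block_mat[of _ m n _ 0 _ 0 _ _ r _ s]; use assms in \<open>auto simp: left_mult_zero_mat\<close>)
qed

lemma vcat_mult:
  fixes E :: "'a :: ring_1 mat"
  assumes "E \<in> carrier_mat n m" "A \<in> carrier_mat r n" "B \<in> carrier_mat s n"
  shows "vcat A B * E = vcat (A * E) (B * E)"
proof -
  have E: "E = four_block_mat E (0\<^sub>m n 0) (0\<^sub>m 0 m) (0\<^sub>m 0 0)"
    by (rule eq_matI) (use assms in auto)
  show ?thesis
    unfolding vcat_def
    by (subst E, subst mult_four_block_mat[of _ r n _ 0 _ s _ _ m _ 0]; use assms in auto)
qed

lemma vcat_mult_hcat:
  fixes A B :: "'a :: ring_1 mat"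
  assumes "A \<in> carrier_mat r n" "B \<in> carrier_mat s n" "C \<in> carrier_mat n k" "D \<in> carrier_mat n l"
  shows "vcat A B * hcat C D = four_block_mat (A * C) (A * D) (B * C) (B * D)"
  unfolding vcat_def hcat_def
  by (subst mult_four_block_mat[of _ r n _ 0 _ s _ _ k _ l]; use assms in auto)

lemma hcat_mult_vcat:
  fixes A B :: "'a :: ring_1 mat"
  assumes "A \<in> carrier_mat n r" "B \<in> carrier_mat n s" "C \<in> carrier_mat r k" "D \<in> carrier_mat s k"
  shows "hcat A B * vcat C D = A * C + B * D"
proof -
  have "hcat A B * vcat C D = four_block_mat (A * C + B * D) (0\<^sub>m n 0) (0\<^sub>m 0 k) (0\<^sub>m 0 0)"
    unfolding vcat_def hcat_def
    by (subst mult_four_block_mat[of _ n r _ s _ 0 _ _ k _ 0]; use assms in auto)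
  also have "\<dots> = A * C + B * D"
    by (rule eq_matI) (use assms in auto)
  finally show ?thesis .
qed

text \<open>\<open>A\<close> and \<open>B\<close> exhibit a free direct summand of rank \<open>r\<close> in the image of \<open>e\<close>, with
  projection \<open>A B\<close>.\<close>

definition splits :: "nat \<Rightarrow> 'a :: ring_1 mat \<Rightarrow> nat \<Rightarrow> 'a mat \<Rightarrow> 'a mat \<Rightarrow> bool" where
  "splits n e r A B \<longleftrightarrow> A \<in> carrier_mat n r \<and> B \<in> carrier_mat r n \<and>
     B * A = 1\<^sub>m r \<and> e * A = A \<and> B * e = B"

text \<open>The remainder \<open>g = e - A B\<close> is an idempotent with \<open>g A = 0\<close>
  and \<open>B g = 0\<close>. Its column \<open>j\<close>, called \<open>a\<close>, and
  \<open>v\<close> times its row \<open>i\<close>, called \<open>b\<close>, satisfy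
  \<open>b a = v * g $$ (i, j) = 1\<close>, so they can be appended to \<open>A\<close> and
  \<open>B\<close>.\<close>

lemma splits_extend:
  fixes e :: "'a :: ring_1 mat"
  assumes e: "e \<in> carrier_mat n n" "e * e = e" and sp: "splits n e r A B"
    and ij: "i < n" "j < n" and unit: "v * (e - A * B) $$ (i, j) = 1"
  shows "\<exists>A' B'. splits n e (Suc r) A' B'"
proof -
  have A: "A \<in> carrier_mat n r" and B: "B \<in> carrier_mat r n"
    and BA: "B * A = 1\<^sub>m r" and eA: "e * A = A" and Be: "B * e = B"
    using sp by (auto simp: splits_def)
  have AB: "A * B \<in> carrier_mat n n" using A B by (rule mult_carrier_mat)
  define g where "g = e - A * B"
  have g: "g \<in> carrier_mat n n" unfolding g_def using AB by (rule minus_carrier_mat)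
  have "g * A = e * A - A * B * A" unfolding g_def by (rule minus_mult_distrib_mat[OF e(1) AB A])
  also have "A * B * A = A" using assoc_mult_mat[OF A B A] BA right_mult_one_mat[OF A] by simp
  finally have gA: "g * A = 0\<^sub>m n r" using A eA by simp
  have "B * g = B * e - B * (A * B)" unfolding g_def by (rule mult_minus_distrib_mat[OF B e(1) AB])
  also have "B * (A * B) = B" using assoc_mult_mat[OF B A B] BA left_mult_one_mat[OF B] by simp
  finally have Bg: "B * g = 0\<^sub>m r n" using B Be by simp
  have "e * g = e * e - e * (A * B)" unfolding g_def by (rule mult_minus_distrib_mat[OF e(1) e(1) AB])
  also have "e * (A * B) = A * B" using assoc_mult_mat[OF e(1) A B] eA by simp
  finally have eg: "e * g = g" using e by (simp add: g_def)
  have "g * e = e * e - A * B * e" unfolding g_def by (rule minus_mult_distrib_mat[OF e(1) AB e(1)])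
  also have "A * B * e = A * B" using assoc_mult_mat[OF A B e(1)] Be by simp
  finally have ge: "g * e = g" using e by (simp add: g_def)
  have "g * g = e * g - A * B * g" by (subst (1) g_def, rule minus_mult_distrib_mat[OF e(1) AB g])
  also have "A * B * g = 0\<^sub>m n n" using assoc_mult_mat[OF A B g] Bg right_mult_zero_mat[OF A] by simp
  finally have gg: "g * g = g" using g eg by (auto intro!: eq_matI)
  define E where "E = mat n 1 (\<lambda>(t, _). if t = j then 1 else (0 :: 'a))"
  define F where "F = mat 1 n (\<lambda>(_, t). if t = i then v else (0 :: 'a))"
  have E: "E \<in> carrier_mat n 1" and F: "F \<in> carrier_mat 1 n" by (auto simp: E_def F_def)
  define a where "a = g * E"
  define b where "b = F * g"
  have a: "a \<in> carrier_mat n 1" and b: "b \<in> carrier_mat 1 n"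
    unfolding a_def b_def using E F g by (auto intro: mult_carrier_mat)
  have ea: "e * a = a" unfolding a_def using assoc_mult_mat[OF e(1) g E] eg by simp
  have be: "b * e = b" unfolding b_def using assoc_mult_mat[OF F g e(1)] ge by simp
  have Ba: "B * a = 0\<^sub>m r 1" unfolding a_def using assoc_mult_mat[OF B g E] Bg left_mult_zero_mat[OF E] by simp
  have bA: "b * A = 0\<^sub>m 1 r" unfolding b_def using assoc_mult_mat[OF F g A] gA right_mult_zero_mat[OF F] by simp
  have "b * a = F * (g * (g * E))" unfolding a_def b_def
    by (rule assoc_mult_mat[OF F g]) (use g E in \<open>auto intro: mult_carrier_mat\<close>)
  also have "g * (g * E) = a" using assoc_mult_mat[OF g g E] gg by (simp add: a_def)
  also have "F * a = 1\<^sub>m 1"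
  proof (rule eq_matI)
    have at: "a $$ (t, 0) = g $$ (t, j)" if "t < n" for t
    proof -
      have "a $$ (t, 0) = (\<Sum>k<n. g $$ (t, k) * (if k = j then 1 else 0))"
        using that g by (simp add: a_def E_def scalar_prod_def atLeast0LessThan)
      also have "\<dots> = g $$ (t, j)" using ij by (simp add: if_distrib[of "\<lambda>x. _ * x"] sum.delta cong: if_cong)
      finally show ?thesis .
    qed
    have "(F * a) $$ (0, 0) = (\<Sum>k<n. (if k = i then v else 0) * a $$ (k, 0))"
      using a by (simp add: F_def scalar_prod_def atLeast0LessThan)
    also have "\<dots> = v * a $$ (i, 0)" using ij by (simp add: if_distrib[of "\<lambda>x. x * _"] sum.delta cong: if_cong)
    also have "\<dots> = 1" using unit ij by (simp add: at g_def)
    finally show "(F * a) $$ (x, y) = 1\<^sub>m 1 $$ (x, y)" if "x < dim_row (1\<^sub>m 1 :: 'a mat)" "y < dim_col (1\<^sub>m 1 :: 'a mat)" for x y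
      using that by simp
  qed (use F a in auto)
  finally have ba: "b * a = 1\<^sub>m 1" .
  have "splits n e (r + 1) (hcat A a) (vcat B b)"
    unfolding splits_def
    using hcat_carrier[OF A a] vcat_carrier[OF B b] vcat_mult_hcat[OF B b A a] mult_hcat[OF e(1) A a]
      vcat_mult[OF e(1) B b] BA Ba bA ba eA ea Be be by simp
  then show ?thesis by auto
qed

text \<open>Multiply the twist identity by \<open>B\<close> on the left and by \<open>A\<close> on
  the right: as \<open>B e = B\<close> and \<open>e A = A\<close>, it becomes
  \<open>B c A + B c A = B c A\<close>. It is applied both to the commutator and to its
  inverse.\<close>

lemma splits_twist_zero:
  fixes e :: "'a :: ring_1 mat"
  assumes "splits n e r A B" and e: "e \<in> carrier_mat n n" and c: "c \<in> carrier_mat n n"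
    and twist: "e * c + c * e = c"
  shows "B * (c * A) = 0\<^sub>m r r"
proof -
  have A: "A \<in> carrier_mat n r" and B: "B \<in> carrier_mat r n" and eA: "e * A = A" and Be: "B * e = B"
    using assms(1) by (auto simp: splits_def)
  have cA: "c * A \<in> carrier_mat n r" using c A by (rule mult_carrier_mat)
  have ecA: "e * (c * A) \<in> carrier_mat n r" using e cA by (rule mult_carrier_mat)
  have X: "B * (c * A) \<in> carrier_mat r r" using B cA by (rule mult_carrier_mat)
  have "c * A = e * c * A + c * e * A"
    using add_mult_distrib_mat[OF mult_carrier_mat[OF e c] mult_carrier_mat[OF c e] A] twist by simp
  also have "c * e * A = c * A" using assoc_mult_mat[OF c e A] eA by simp
  also have "e * c * A = e * (c * A)" by (rule assoc_mult_mat[OF e c A])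
  finally have "B * (c * A) = B * (e * (c * A) + c * A)" by simp
  also have "\<dots> = B * (e * (c * A)) + B * (c * A)" by (rule mult_add_distrib_mat[OF B ecA cA])
  also have "B * (e * (c * A)) = B * (c * A)" using assoc_mult_mat[OF B e cA] Be by simp
  finally have "B * (c * A) + B * (c * A) = B * (c * A) + 0\<^sub>m r r" using X by simp
  then show ?thesis by (rule add_left_cancel_mat[OF X zero_carrier_mat X])
qed

section \<open>Maximal free summands and parity of the size\<close>

context local_type
begin

text \<open>Rank 0 is always possible and ranks are at most \<open>n\<close>, so a greatest rank
  exists. A unit entry of \<open>e - A B\<close> would allow a further extension.\<close>

lemma maximal_splits:
  assumes e: "e \<in> carrier_mat n n" "e * e = e"
  shows "\<exists>r A B. splits n e r A B \<and> (\<forall>i<n. \<forall>j<n. (e - A * B) $$ (i, j) \<in> N)"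
proof -
  let ?P = "\<lambda>r. \<exists>A B. splits n e r A B"
  have "splits n e 0 (0\<^sub>m n 0) (0\<^sub>m 0 n)"
    unfolding splits_def using e by (auto intro!: eq_matI)
  then have "?P 0" by blast
  have bound: "r \<le> n" if "?P r" for r
    using that dim_le_if_inverse unfolding splits_def by blast
  define r where "r = (GREATEST r. ?P r)"
  have "?P r" unfolding r_def by (rule GreatestI_nat[of ?P, OF \<open>?P 0\<close> bound])
  then obtain A B where sp: "splits n e r A B" by blast
  have "\<not> ?P (Suc r)"
    using Greatest_le_nat[of ?P "Suc r" n] bound unfolding r_def[symmetric] by fastforce
  then have "(e - A * B) $$ (i, j) \<in> N" if "i < n" "j < n" for i j
    using splits_extend[OF e sp that] unfolding mem_iff ring_unit_def by blast
  with sp show ?thesis by blast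
qed

lemma mat_mult_mem:
  assumes "X \<in> carrier_mat n n" "Y \<in> carrier_mat n n" "i < n" "j < n"
    and "(\<forall>i<n. \<forall>j<n. X $$ (i, j) \<in> N) \<or> (\<forall>i<n. \<forall>j<n. Y $$ (i, j) \<in> N)"
  shows "(X * Y) $$ (i, j) \<in> N"
proof -
  have "(X * Y) $$ (i, j) = (\<Sum>t<n. X $$ (i, t) * Y $$ (t, j))"
    using assms(1-4) by (simp add: scalar_prod_def atLeast0LessThan)
  also have "\<dots> \<in> N" using assms(3-5) by (intro sum_mem) (auto intro: mult_left_mem mult_right_mem)
  finally show ?thesis .
qed

text \<open>Let \<open>X\<close> be the block row \<open>(A, d A)\<close> and \<open>Y\<close> the
  block column \<open>(B, B c)\<close>. Then \<open>Y X = 1\<close> gives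
  \<open>2 r \<le> n\<close>, and \<open>X Y = 1\<close> modulo \<open>N\<close> gives
  \<open>n \<le> 2 r\<close>.\<close>

lemma mat_K_witness_even_local:
  fixes e e' d :: "'a mat"
  assumes K: "mat_K_witness n e e' d"
  shows "even n"
proof -
  define c where "c = e * e' - e' * e"
  have c: "c \<in> carrier_mat n n" and twist: "e * c + c * e = c"
    using mat_K_witness_twist[OF K] unfolding c_def by auto
  have e: "e \<in> carrier_mat n n" "e * e = e" and d: "d \<in> carrier_mat n n"
    and cd: "c * d = 1\<^sub>m n" and dc: "d * c = 1\<^sub>m n"
    using K by (auto simp: mat_K_witness_def c_def)
  obtain r A B where sp: "splits n e r A B"
    and g_mem: "\<forall>i<n. \<forall>j<n. (e - A * B) $$ (i, j) \<in> N"
    using maximal_splits[OF e] by blast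
  have A: "A \<in> carrier_mat n r" and B: "B \<in> carrier_mat r n"
    and BA: "B * A = 1\<^sub>m r" and eA: "e * A = A" and Be: "B * e = B"
    using sp by (auto simp: splits_def)
  have AB: "A * B \<in> carrier_mat n n" using A B by (rule mult_carrier_mat)
  have ec: "e * c \<in> carrier_mat n n" and ce: "c * e \<in> carrier_mat n n" and de: "d * e \<in> carrier_mat n n"
    and ed: "e * d \<in> carrier_mat n n"
    using e c d by (auto intro: mult_carrier_mat)
  have dA: "d * A \<in> carrier_mat n r" and Bc: "B * c \<in> carrier_mat r n"
    using A B c d by (auto intro: mult_carrier_mat)
  have BcA: "B * c * A = 0\<^sub>m r r"
    using splits_twist_zero[OF sp e(1) c twist] assoc_mult_mat[OF B c A] by simp
  have "d * (e * c) + d * (c * e) = 1\<^sub>m n"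
    using mult_add_distrib_mat[OF d ec ce] twist dc by simp
  then have complement: "d * (e * c) + e = 1\<^sub>m n"
    using assoc_mult_mat[OF d c e(1)] dc left_mult_one_mat[OF e(1)] by simp
  \<comment> \<open>Multiplying \<open>d e c = 1 - e\<close> by \<open>d\<close> on the right gives
    \<open>d e = d - e d\<close>, so \<open>d\<close> satisfies the same identity as
    \<open>c\<close>.\<close>
  have twist_d: "e * d + d * e = d"
  proof -
    from complement have "d * (e * c) * d + e * d = d"
      using add_mult_distrib_mat[OF mult_carrier_mat[OF d ec] e(1) d] left_mult_one_mat[OF d] by simp
    moreover have "d * (e * c) * d = d * e"
      using assoc_mult_mat[OF d ec d] assoc_mult_mat[OF e(1) c d] cd right_mult_one_mat[OF e(1)] by simp
    ultimately show ?thesis using comm_add_mat[OF ed de] by simp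
  qed
  have BdA: "B * (d * A) = 0\<^sub>m r r"
    by (rule splits_twist_zero[OF sp e(1) d twist_d])
  have one: "B * c * (d * A) = 1\<^sub>m r"
  proof -
    have "B * c * (d * A) = B * (c * (d * A))" by (rule assoc_mult_mat[OF B c dA])
    also have "c * (d * A) = A" using assoc_mult_mat[OF c d A] cd left_mult_one_mat[OF A] by simp
    finally show ?thesis using BA by simp
  qed
  let ?X = "hcat A (d * A)" and ?Y = "vcat B (B * c)"
  have X: "?X \<in> carrier_mat n (r + r)" and Y: "?Y \<in> carrier_mat (r + r) n"
    by (rule hcat_carrier[OF A dA], rule vcat_carrier[OF B Bc])
  have "?Y * ?X = 1\<^sub>m (r + r)"
    unfolding vcat_mult_hcat[OF B Bc A dA] BA BdA BcA one by simp
  then have "r + r \<le> n" by (rule dim_le_if_inverse[OF Y X])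
  moreover have "n \<le> r + r"
  proof (rule dim_le_if_mod_inverse[OF X Y])
    fix i l assume il: "i < n" "l < n"
    define g where "g = e - A * B"
    have g: "g \<in> carrier_mat n n" unfolding g_def using AB by (rule minus_carrier_mat)
    have gc: "g * c \<in> carrier_mat n n" using g c by (rule mult_carrier_mat)
    have ABc: "A * B * c \<in> carrier_mat n n" using AB c by (rule mult_carrier_mat)
    have "d * (g * c) = d * (e * c) - d * (A * B * c)"
      unfolding g_def minus_mult_distrib_mat[OF e(1) AB c] by (rule mult_minus_distrib_mat[OF d ec ABc])
    also have "d * (A * B * c) = d * A * (B * c)"
      using assoc_mult_mat[OF A B c] assoc_mult_mat[OF d A Bc] by simp
    finally have 1: "d * (g * c) = d * (e * c) - d * A * (B * c)" .
    have dec: "d * (e * c) \<in> carrier_mat n n" using d ec by (rule mult_carrier_mat)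
    have dABc: "d * A * (B * c) \<in> carrier_mat n n" using dA Bc by (rule mult_carrier_mat)
    have rearrange: "(P + Q) - (D + E) = - ((E - P) + (D - Q))"
      if "P \<in> carrier_mat n n" "Q \<in> carrier_mat n n" "D \<in> carrier_mat n n" "E \<in> carrier_mat n n"
      for P Q D E :: "'a mat"
      using that by (intro eq_matI) auto
    \<comment> \<open>Writing 1 as \<open>d e c + e\<close> and grouping each term with its
      counterpart leaves \<open>- (g + d g c)\<close>, and all entries of \<open>g\<close> are in
      \<open>N\<close>.\<close>
    have "?X * ?Y - 1\<^sub>m n = (A * B + d * A * (B * c)) - (d * (e * c) + e)"
      by (simp only: hcat_mult_vcat[OF A dA B Bc] complement)
    also have "\<dots> = - (g + d * (g * c))"
      unfolding 1 by (simp only: g_def rearrange[OF AB dABc dec e(1)])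
    finally have "(?X * ?Y - 1\<^sub>m n) $$ (i, l) = - (g $$ (i, l) + (d * (g * c)) $$ (i, l))"
      using il g mult_carrier_mat[OF d gc] by (simp del: index_mult_mat)
    moreover have "(d * (g * c)) $$ (i, l) \<in> N"
      using mat_mult_mem[OF d gc il] mat_mult_mem[OF g c] g_mem unfolding g_def by blast
    moreover have "g $$ (i, l) \<in> N" using g_mem il by (simp add: g_def)
    ultimately show "(?X * ?Y - 1\<^sub>m n) $$ (i, l) \<in> N"
      by (simp only: minus_mem add_mem)
  qed
  ultimately have "n = r + r" by simp
  then show ?thesis by simp
qed

text \<open>If \<open>1\<close> were not a sum of two units, the residue ring would be the field with two
  elements, to which the commutative case applies.\<close>

lemma mat_K_witness_2_local:
  fixes e e' d :: "'a mat"
  assumes K: "mat_K_witness 2 e e' d"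
  shows "\<exists>u :: 'a. ring_unit u \<and> ring_unit (1 - u)"
proof (rule ccontr)
  assume "\<not> ?thesis"
  then have mem: "1 - u \<in> N" if "u \<notin> N" for u using that by (auto simp: mem_iff)
  define h :: "'a \<Rightarrow> bit" where "h x = (if x \<in> N then 0 else 1)" for x
  have h_add: "h (x + y) = h x + h y" for x y
  proof -
    consider "x \<in> N" "y \<in> N" | "x \<in> N" "y \<notin> N" | "x \<notin> N" "y \<in> N" | "x \<notin> N" "y \<notin> N" by blast
    then show ?thesis
    proof cases
      case 1 then show ?thesis by (simp add: h_def add_mem)
    next
      case 2 then have "x + y \<notin> N" using diff_mem[of "x + y" x] by auto
      with 2 show ?thesis by (simp add: h_def)
    next
      case 3 then have "x + y \<notin> N" using diff_mem[of "x + y" y] by auto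
      with 3 show ?thesis by (simp add: h_def)
    next
      case 4
      have "- y \<notin> N" using 4 minus_mem[of "- y"] by auto
      then have "1 + y \<in> N" using mem[of "- y"] by simp
      \<comment> \<open>In residue terms \<open>1 + 1 = 0\<close>: both \<open>- y\<close> and
        \<open>x\<close> are units, hence congruent to 1.\<close>
      then have "(1 + y) - (1 - x) \<in> N" using mem[OF 4(1)] by (rule diff_mem)
      moreover have "(1 + y) - (1 - x) = x + y" by (simp add: add.commute)
      ultimately show ?thesis using 4 by (simp add: h_def)
    qed
  qed
  have h_mult: "h (x * y) = h x * h y" for x y
  proof (cases "x \<in> N \<or> y \<in> N")
    case False
    \<comment> \<open>The two elements add up to \<open>1 - x * y\<close>.\<close>
    then have "(1 - x) * y \<in> N" "1 - y \<in> N" using mem by (auto intro: mult_right_mem)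
    then have "(1 - x) * y + (1 - y) \<in> N" by (rule add_mem)
    then have "1 - x * y \<in> N" by (simp add: left_diff_distrib)
    then have "x * y \<notin> N" using add_mem[of "1 - x * y" "x * y"] one_not_mem by auto
    with False show ?thesis by (simp add: h_def)
  qed (auto simp: h_def mult_left_mem mult_right_mem)
  have "Ring_Hom.ring_hom h"
    by unfold_locales (simp_all add: h_add h_mult, simp_all add: h_def zero_mem one_not_mem)
  from mat_K_witness_2_comm[OF mat_K_witness_hom[OF this K]]
  obtain u :: bit where "ring_unit u" "ring_unit (1 - u)" by blast
  then show False by (cases u) (auto simp: ring_unit_def)
qed

end

section \<open>The residue ring\<close>

lemma local_type_nonunits:
  assumes "local_ring (class_ring :: 'a :: ring_1 ring)"
  shows "local_type (nonunits (class_ring :: 'a ring))"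
proof -
  interpret ideal "nonunits class_ring" "class_ring :: 'a ring"
    using assms by (simp add: local_ring_def)
  show ?thesis
  proof
    fix x y :: 'a
    show "x \<in> nonunits class_ring \<longleftrightarrow> \<not> ring_unit x"
      by (simp add: nonunits_def Units_class_ring)
    show "(0 :: 'a) \<in> nonunits class_ring" using zero_closed by simp
    assume x: "x \<in> nonunits class_ring"
    show "y * x \<in> nonunits class_ring" using I_l_closed[OF x, of y] by simp
    show "x * y \<in> nonunits class_ring" using I_r_closed[OF x, of y] by simp
    assume y: "y \<in> nonunits class_ring"
    show "x + y \<in> nonunits class_ring" using a_closed[OF x y] by simp
  qed
qed

text \<open>Units are the elements outside \<open>N\<close>, so \<open>u\<close> and
  \<open>1 - u\<close> are both units exactly when the class of \<open>u\<close> differs from those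
  of 0 and 1. Infinite quotients are listed separately because \<open>card\<close> is 0 on infinite
  sets.\<close>

lemma residue_card_gt_2_iff:
  fixes N :: "'a :: ring_1 set"
  assumes "local_type N"
  shows "(\<exists>u :: 'a. ring_unit u \<and> ring_unit (1 - u)) \<longleftrightarrow>
    infinite (carrier (class_ring Quot N)) \<or> card (carrier (class_ring Quot N)) > 2"
proof -
  interpret local_type N by fact
  define co where "co x = (\<lambda>h. h + x) ` N" for x
  have carrier: "carrier (class_ring Quot N) = range co"
    unfolding FactRing_def A_RCOSETS_def RCOSETS_def r_coset_def co_def by auto
  have co_eq: "co x = co y \<longleftrightarrow> x - y \<in> N" for x y
  proof
    assume "co x = co y"
    then have "0 + x \<in> co y" using zero_mem unfolding co_def by blast
    then show "x - y \<in> N" unfolding co_def by auto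
  next
    have sub: "co x \<subseteq> co y" if "x - y \<in> N" for x y
    proof
      fix z assume "z \<in> co x"
      then obtain h where h: "h \<in> N" "z = h + x" unfolding co_def by auto
      then have "z = (h + (x - y)) + y" by simp
      then show "z \<in> co y" unfolding co_def using add_mem[OF h(1) that] by blast
    qed
    assume "x - y \<in> N"
    moreover from minus_mem[OF this] have "y - x \<in> N" by simp
    ultimately show "co x = co y" using sub by blast
  qed
  show ?thesis unfolding carrier
  proof
    assume "\<exists>u :: 'a. ring_unit u \<and> ring_unit (1 - u)"
    then obtain u where u: "u \<notin> N" "1 - u \<notin> N" by (auto simp: mem_iff)
    have "card {co 0, co u, co 1} = 3"
      using u one_not_mem minus_mem[of "- u"] minus_mem[of "u - 1"] minus_mem[of "- 1"]
      by (auto simp: co_eq card_insert_if)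
    then show "infinite (range co) \<or> 2 < card (range co)"
      using card_mono[of "range co" "{co 0, co u, co 1}"] by force
  next
    assume *: "infinite (range co) \<or> 2 < card (range co)"
    show "\<exists>u :: 'a. ring_unit u \<and> ring_unit (1 - u)"
    proof (rule ccontr)
      assume "\<not> ?thesis"
      then have mem: "x \<in> N \<or> x - 1 \<in> N" for x using minus_mem[of "1 - x"] by (auto simp: mem_iff)
      have "range co \<subseteq> {co 0, co 1}"
      proof
        fix z assume "z \<in> range co"
        then obtain x where "z = co x" by blast
        then show "z \<in> {co 0, co 1}" using mem[of x] by (auto simp: co_eq)
      qed
      then have "finite (range co)" "card (range co) \<le> card {co 0, co 1}"
        by (auto intro: finite_subset card_mono)
      moreover have "card {co 0, co 1} \<le> 2" by (simp add: card_insert_if)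
      ultimately show False using * by simp
    qed
  qed
qed

theorem theoremC:
  fixes n :: nat
  defines "T \<equiv> (class_ring :: 'a :: ring_1 ring)"
  defines "R \<equiv> ring_mat TYPE('a) n ()"
  assumes "n \<ge> 1"
    and "local_ring T \<or> cring T"
  shows "(property_K R \<longleftrightarrow>
            (even n \<and> n \<ge> 4) \<or> (n = 2 \<and> \<one>\<^bsub>T\<^esub> \<in> Units T <+>\<^bsub>T\<^esub> Units T)) \<and>
         (local_ring T \<longrightarrow>
            (\<one>\<^bsub>T\<^esub> \<in> Units T <+>\<^bsub>T\<^esub> Units T \<longleftrightarrow>
             infinite (carrier (T Quot nonunits T)) \<or> card (carrier (T Quot nonunits T)) > 2))"
proof -
  have sum_iff: "\<one>\<^bsub>T\<^esub> \<in> Units T <+>\<^bsub>T\<^esub> Units T \<longleftrightarrow> (\<exists>u :: 'a. ring_unit u \<and> ring_unit (1 - u))"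
    unfolding T_def using one_sum_of_units_iff by simp
  have "property_K R"
    if asm: "(even n \<and> n \<ge> 4) \<or> (n = 2 \<and> (\<exists>u :: 'a. ring_unit u \<and> ring_unit (1 - u)))"
  proof -
    \<comment> \<open>The half size \<open>k\<close> is 1 in the case \<open>n = 2\<close>, where
      the hypothesis on units enters; from \<open>k = 2\<close> on the decomposition always
      exists.\<close>
    obtain k where k: "n = k + k" "sum_two_units_mat TYPE('a) k"
    proof (cases "n = 2")
      case True
      with asm obtain u :: 'a where "ring_unit u" "ring_unit (1 - u)" by auto
      from that[OF _ sum_two_units_mat_1[OF this]] True show ?thesis by simp
    next
      case False
      with asm have "even n" "n \<ge> 4" by auto
      then show ?thesis
        by (intro that[of "n div 2"] sum_two_units_mat_ge_2) auto
    qed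
    then show ?thesis
      unfolding R_def property_K_ring_mat_iff using mat_K_witness_if_sum_two_units by blast
  qed
  moreover have "even n \<and> (n = 2 \<longrightarrow> (\<exists>u :: 'a. ring_unit u \<and> ring_unit (1 - u)))" if pk: "property_K R"
  proof -
    obtain e e' d :: "'a mat" where K: "mat_K_witness n e e' d"
      using pk unfolding R_def property_K_ring_mat_iff by blast
    from assms(4) show ?thesis
    proof
      assume "local_ring T"
      then interpret local_type "nonunits (class_ring :: 'a ring)"
        unfolding T_def by (rule local_type_nonunits)
      show ?thesis using mat_K_witness_even_local[OF K] mat_K_witness_2_local K by blast
    next
      assume "cring T"
      then have "x * y = y * x" for x y :: 'a
        using cring.cring_simprules(14)[of T x y] unfolding T_def by simp
      from mat_K_witness_commutative[OF this K] show ?thesis by blast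
    qed
  qed
  \<comment> \<open>Because \<open>n \<ge> 1\<close> excludes size 0, 2 is the only even size below
    4.\<close>
  moreover have "even n \<and> n \<noteq> 2 \<longleftrightarrow> even n \<and> n \<ge> 4" using assms(3) by (auto elim!: evenE)
  ultimately show ?thesis
    unfolding sum_iff
    using residue_card_gt_2_iff[OF local_type_nonunits] unfolding T_def by blast
qed

end
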